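(* Let $\mathbf{Y}$ be a $d$-variate multivariate Pareto random vector with extremal functions $\mathbf{W}^k$, $k\in[d]$. If $\mathbf{W}^k$ is associated for each $k\in[d]$, then $\mathbf{Y}$ is extremal associated.
   Context: Write $[d]=\{1,\ldots,d\}$ and $\mathbf{1}=(1,\ldots,1)^T\in\mathbb{R}^d$. Association: a function $f:\mathbb{R}^d\to\mathbb{R}$ is increasing if $x_i\le x_i'$ for all $i$ implies $f(\mathbf{x})\le f(\mathbf{x}')$. A random vector $\mathbf{X}$ is (positively) associated if $\operatorname{Cov}(f(\mathbf{X}),g(\mathbf{X}))\ge 0$ for all increasing $f,g$ for which the covariance exists. Multivariate Pareto vector: a random vector $\mathbf{Y}$ supported on $\mathcal{L}=\{\mathbf{x}\in\mathbb{R}^d:\|\mathbf{x}\|_\infty>0\}$ (where, for threshold exceedances, $\|\mathbf{x}\|_\infty>0$ means that at least one coordinate of $\mathbf{x}$ is positive) that arises as the limit $\mathbb{P}(\mathbf{Y}\le\mathbf{y})=\lim_{u\to\infty}\mathbb{P}(\mathbf{X}-u\mathbf{1}\le\mathbf{y}\mid\|\mathbf{X}\|_\infty>u)$ for a random vector $\mathbf{X}$ that is multivariate regularly varying and normalized to standard exponential margins. Extremal functions: for $k\in[d]$ let $\mathbf{Y}^k$ denote a random vector with the conditional law of $\mathbf{Y}$ given $Y_k>0$. It is a known property of multivariate Pareto vectors that $\mathbf{Y}^k\stackrel{d}{=}E\mathbf{1}+\mathbf{W}^k$, where $E$ is a standard exponential random variable independent of an $\mathbb{R}^d$-valued random vector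 $\mathbf{W}^k$ with $W^k_k=0$ almost surely. The vector $\mathbf{W}^k$ is called the $k$th extremal function of $\mathbf{Y}$. Extremal association: $\mathbf{Y}$ is called extremal associated if and only if $\mathbf{Y}^k$ is associated for each $k\in[d]$. *)

theory Defs
  imports "HOL-Probability.Probability"
begin

text \<open>
  Random vectors take values in \<open>real ^ 'd\<close>; its order is the componentwise one, so that \<open>mono f\<close>
  says that \<open>f\<close> is increasing and \<open>Y \<omega> \<le> y\<close> is the event of the joint distribution function.
\<close>

definition covariance :: "'a measure \<Rightarrow> ('a \<Rightarrow> real) \<Rightarrow> ('a \<Rightarrow> real) \<Rightarrow> real" where
  "covariance M U V = (\<integral>\<omega>. (U \<omega> - (\<integral>\<eta>. U \<eta> \<partial>M)) * (V \<omega> - (\<integral>\<eta>. V \<eta> \<partial>M)) \<partial>M)"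

definition covariance_exists :: "'a measure \<Rightarrow> ('a \<Rightarrow> real) \<Rightarrow> ('a \<Rightarrow> real) \<Rightarrow> bool" where
  "covariance_exists M U V \<longleftrightarrow>
     integrable M U \<and> integrable M V \<and> integrable M (\<lambda>\<omega>. U \<omega> * V \<omega>)"

text \<open>
  The test functions are required to be Borel: an increasing function on \<open>real ^ 'd\<close> need not be,
  and otherwise association would not depend on the law of \<open>X\<close> alone.
\<close>
definition associated :: "'a measure \<Rightarrow> ('a \<Rightarrow> real ^ 'd::finite) \<Rightarrow> bool" where
  "associated M X \<longleftrightarrow>
     (\<forall>f g :: real ^ 'd \<Rightarrow> real.
        mono f \<and> mono g \<and> f \<in> borel_measurable borel \<and> g \<in> borel_measurable borel \<and>
        covariance_exists M (\<lambda>\<omega>. f (X \<omega>)) (\<lambda>\<omega>. g (X \<omega>)) \<longrightarrow>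
        0 \<le> covariance M (\<lambda>\<omega>. f (X \<omega>)) (\<lambda>\<omega>. g (X \<omega>)))"

text \<open>
  Multivariate regular variation: \<open>t * P(Z / b(t) \<in> \<cdot>)\<close> converges, on the continuity sets bounded
  away from the origin, to a nonzero measure \<open>\<nu>\<close> that is finite on sets bounded away from the
  origin. These sets may be unbounded, so no mass of the limit sits at infinity.
\<close>
definition multivariate_regularly_varying :: "'a measure \<Rightarrow> ('a \<Rightarrow> real ^ 'd::finite) \<Rightarrow> bool" where
  "multivariate_regularly_varying M Z \<longleftrightarrow>
     Z \<in> borel_measurable M \<and>
     (\<exists>(\<nu> :: (real ^ 'd) measure) (b :: real \<Rightarrow> real).
        sets \<nu> = sets borel \<and> emeasure \<nu> {0} = 0 \<and> emeasure \<nu> UNIV \<noteq> 0 \<and>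
        (\<forall>A \<in> sets borel. 0 \<notin> closure A \<longrightarrow> emeasure \<nu> A < \<infinity>) \<and>
        filterlim b at_top at_top \<and>
        (\<forall>A \<in> sets borel. 0 \<notin> closure A \<and> emeasure \<nu> (frontier A) = 0 \<longrightarrow>
           ((\<lambda>t. t * \<P>(\<omega> in M. Z \<omega> /\<^sub>R b t \<in> A)) \<longlongrightarrow> measure \<nu> A) at_top))"

text \<open>
  On the scale with standard exponential margins, \<open>X\<close> itself has light tails; regular variation
  refers to the vector \<open>exp X\<close> (componentwise), which has standard Pareto margins.
\<close>
definition regularly_varying_exp_margins :: "'a measure \<Rightarrow> ('a \<Rightarrow> real ^ 'd::finite) \<Rightarrow> bool" where
  "regularly_varying_exp_margins M X \<longleftrightarrow>
     X \<in> borel_measurable M \<and>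
     (\<forall>i. distributed M lborel (\<lambda>\<omega>. X \<omega> $ i) (exponential_density 1)) \<and>
     multivariate_regularly_varying M (\<lambda>\<omega>. \<chi> i. exp (X \<omega> $ i))"

text \<open>
  The vector \<open>X\<close> in whose threshold exceedances \<open>Y\<close> arises enters only through its law \<open>P\<close>, so it is
  taken to be the identity on \<open>(real ^ 'd, P)\<close>. The conditioning event is that at least one
  coordinate exceeds \<open>u\<close>.
\<close>
definition multivariate_pareto :: "'a measure \<Rightarrow> ('a \<Rightarrow> real ^ 'd::finite) \<Rightarrow> bool" where
  "multivariate_pareto M Y \<longleftrightarrow>
     Y \<in> borel_measurable M \<and>
     (AE \<omega> in M. \<exists>i. 0 < Y \<omega> $ i) \<and>
     (\<exists>P :: (real ^ 'd) measure.
        prob_space P \<and> sets P = sets borel \<and>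
        regularly_varying_exp_margins P (\<lambda>x. x) \<and>
        (\<forall>y. ((\<lambda>u. \<P>(x in P. x - u *\<^sub>R 1 \<le> y \<bar> \<exists>i. u < x $ i))
                \<longlongrightarrow> \<P>(\<omega> in M. Y \<omega> \<le> y)) at_top))"

text \<open>
  The random vector with the law of \<open>Y\<close> given \<open>Y $ k > 0\<close> is \<open>Y\<close> itself, viewed on the
  conditioned space.
\<close>
definition given_exceeds :: "'a measure \<Rightarrow> ('a \<Rightarrow> real ^ 'd::finite) \<Rightarrow> 'd \<Rightarrow> 'a measure" where
  "given_exceeds M Y k = uniform_measure M {\<omega> \<in> space M. 0 < Y \<omega> $ k}"

text \<open>
  \<open>W\<close>, on the probability space \<open>N\<close>, is a version of the \<open>k\<close>-th extremal function of \<open>Y\<close>. The standard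
  exponential variable independent of \<open>W\<close> is realised on the product space, so that \<open>N\<close> need not
  carry it; see the lemma below for the case where it does.
\<close>
definition extremal_function ::
    "'a measure \<Rightarrow> ('a \<Rightarrow> real ^ 'd::finite) \<Rightarrow> 'd \<Rightarrow> 'b measure \<Rightarrow> ('b \<Rightarrow> real ^ 'd) \<Rightarrow> bool" where
  "extremal_function M Y k N W \<longleftrightarrow>
     W \<in> borel_measurable N \<and>
     (AE \<omega> in N. W \<omega> $ k = 0) \<and>
     distr (given_exceeds M Y k) borel Y =
       distr (density lborel (exponential_density 1) \<Otimes>\<^sub>M distr N borel W) borel
         (\<lambda>(e, w). e *\<^sub>R 1 + w)"

lemma extremal_functionI:
  fixes W :: "'b \<Rightarrow> real ^ 'd::finite"
  assumes E: "distributed N lborel E (exponential_density 1)"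
    and W: "W \<in> borel_measurable N"
    and indep: "distr N (borel \<Otimes>\<^sub>M borel) (\<lambda>\<omega>. (E \<omega>, W \<omega>)) = distr N borel E \<Otimes>\<^sub>M distr N borel W"
    and W0: "AE \<omega> in N. W \<omega> $ k = 0"
    and law: "distr (given_exceeds M Y k) borel Y = distr N borel (\<lambda>\<omega>. E \<omega> *\<^sub>R 1 + W \<omega>)"
  shows "extremal_function M Y k N W"
proof -
  have rv: "E \<in> borel_measurable N"
    using distributed_measurable[OF E] by simp
  have "distr N borel E = distr N lborel E"
    by (rule distr_cong) auto
  also have "\<dots> = density lborel (exponential_density 1)"
    using E by (simp add: distributed_def)
  finally have 1: "density lborel (exponential_density 1) = distr N borel E" ..
  have "distr (distr N (borel \<Otimes>\<^sub>M borel) (\<lambda>\<omega>. (E \<omega>, W \<omega>))) borel (\<lambda>(e, w). e *\<^sub>R 1 + w)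
      = distr N borel (\<lambda>\<omega>. E \<omega> *\<^sub>R 1 + W \<omega>)"
    using rv W by (subst distr_distr) (auto simp: comp_def)
  then show ?thesis
    using W W0 law unfolding extremal_function_def 1 indep[symmetric] by simp
qed

definition extremal_associated :: "'a measure \<Rightarrow> ('a \<Rightarrow> real ^ 'd::finite) \<Rightarrow> bool" where
  "extremal_associated M Y \<longleftrightarrow> (\<forall>k. associated (given_exceeds M Y k) Y)"

end

theory Submission
  imports Defs
begin

text \<open>
  Association is a property of the law, so it suffices to treat the vector \<open>E \<one> + W\<close> on the product
  of the law of a real variable \<open>E\<close> with the law of \<open>W\<close>. Let \<open>f\<close> and \<open>g\<close> be increasing, and
  integrate over \<open>w\<close> first. For fixed \<open>e\<close> the maps \<open>w \<mapsto> f (e \<one> + w)\<close> and \<open>w \<mapsto> g (e \<one> + w)\<close> are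
  increasing, so association of \<open>W\<close> gives \<open>F e * G e \<le> H e\<close>, where \<open>F\<close>, \<open>G\<close>, \<open>H\<close> denote the
  conditional expectations of \<open>f\<close>, \<open>g\<close>, \<open>f * g\<close> given \<open>E = e\<close>. The functions \<open>F\<close> and \<open>G\<close> are
  increasing in the single real variable \<open>e\<close>, and increasing functions of one real variable are
  always nonnegatively correlated (Chebyshev's inequality). Together these bound the expectation of
  \<open>f * g\<close> from below by the product of the expectations of \<open>f\<close> and \<open>g\<close>.

  Fubini's theorem provides \<open>F\<close>, \<open>G\<close>, \<open>H\<close> only for almost every \<open>e\<close>, and says nothing
  about integrability of \<open>F * G\<close>. Chebyshev's inequality is therefore proved in a form that allows
  an exceptional null set and mentions only the integrable majorant \<open>H\<close> of \<open>F * G\<close>.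
\<close>

lemma (in prob_space) covariance_eq:
  fixes U V :: "'a \<Rightarrow> real"
  assumes "covariance_exists M U V"
  shows "covariance M U V = expectation (\<lambda>x. U x * V x) - expectation U * expectation V"
proof -
  have [simp]: "integrable M U" "integrable M V" "integrable M (\<lambda>x. U x * V x)"
    using assms by (auto simp: covariance_exists_def)
  have "covariance M U V = expectation (\<lambda>x. U x * V x - expectation V * U x
      - expectation U * V x + expectation U * expectation V)"
    by (simp add: covariance_def algebra_simps)
  also have "\<dots> = expectation (\<lambda>x. U x * V x) - expectation U * expectation V"
    by (simp add: prob_space)
  finally show ?thesis .
qed

lemma associated_distr:
  fixes X :: "'a \<Rightarrow> real ^ 'd::finite"
  assumes [measurable]: "X \<in> borel_measurable M"
  shows "associated (distr M borel X) (\<lambda>x. x) \<longleftrightarrow> associated M X"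
proof -
  have "covariance_exists (distr M borel X) f g = covariance_exists M (\<lambda>x. f (X x)) (\<lambda>x. g (X x))"
       "covariance (distr M borel X) f g = covariance M (\<lambda>x. f (X x)) (\<lambda>x. g (X x))"
    if [measurable]: "f \<in> borel_measurable borel" "g \<in> borel_measurable borel"
    for f g :: "real ^ 'd \<Rightarrow> real"
    by (simp_all add: covariance_exists_def covariance_def integrable_distr_eq integral_distr)
  then show ?thesis
    unfolding associated_def by auto
qed

lemma (in prob_space) associated_expectation_mult_le:
  fixes X :: "'a \<Rightarrow> real ^ 'd::finite"
  assumes "associated M X" "mono f" "mono g"
    and "f \<in> borel_measurable borel" "g \<in> borel_measurable borel"
    and ex: "covariance_exists M (\<lambda>x. f (X x)) (\<lambda>x. g (X x))"
  shows "expectation (\<lambda>x. f (X x)) * expectation (\<lambda>x. g (X x))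
           \<le> expectation (\<lambda>x. f (X x) * g (X x))"
  using assms covariance_eq[OF ex] unfolding associated_def by force

text \<open>
  Expand \<open>0 \<le> (F x - F y) * (G x - G y)\<close>, bound both \<open>F x * G x\<close> and \<open>F y * G y\<close> by \<open>H\<close>, and
  integrate over \<open>x\<close> and then over \<open>y\<close>. The products are bounded before integrating because they
  might not be integrable themselves.
\<close>
lemma (in prob_space) chebyshev_expectation_le:
  fixes F G H :: "'a \<Rightarrow> real"
  assumes [simp]: "integrable M F" "integrable M G" "integrable M H"
    and good: "AE x in M. P x"
    and comonotone: "\<And>x y. P x \<Longrightarrow> P y \<Longrightarrow> 0 \<le> (F x - F y) * (G x - G y)"
    and le: "\<And>x. P x \<Longrightarrow> F x * G x \<le> H x"
  shows "expectation F * expectation G \<le> expectation H"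
proof -
  have "0 \<le> expectation H + H y - G y * expectation F - F y * expectation G" if y: "P y" for y
  proof -
    have "AE x in M. 0 \<le> H x + H y - G y * F x - F y * G x"
      using good
    proof eventually_elim
      case (elim x)
      show ?case
        using comonotone[OF elim y] le[OF elim] le[OF y] by (simp add: algebra_simps)
    qed
    then have "0 \<le> expectation (\<lambda>x. H x + H y - G y * F x - F y * G x)"
      by (rule integral_nonneg_AE)
    then show ?thesis
      by (simp add: prob_space)
  qed
  then have "AE y in M. 0 \<le> expectation H + H y - G y * expectation F - F y * expectation G"
    using good by auto
  then have "0 \<le> expectation (\<lambda>y. expectation H + H y - G y * expectation F - F y * expectation G)"
    by (rule integral_nonneg_AE)
  then show ?thesis
    by (simp add: prob_space algebra_simps)
qed

text \<open>
  Given the shift \<open>e\<close>, association of \<open>L\<close> handles the dependence through \<open>w\<close>; what remains is the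
  dependence through \<open>e\<close>, which all coordinates share with the same sign, so that the conditional
  expectations are increasing in a single real variable.
\<close>
lemma associated_diagonal_shift:
  fixes L :: "(real ^ 'd::finite) measure" and D :: "real measure"
  assumes "prob_space D" "prob_space L"
    and [measurable_cong]: "sets D = sets borel" "sets L = sets borel"
    and assoc: "associated L (\<lambda>w. w)"
  shows "associated (D \<Otimes>\<^sub>M L) (\<lambda>(e, w). e *\<^sub>R 1 + w)"
  unfolding associated_def
proof (intro allI impI, elim conjE)
  interpret D: prob_space D by fact
  interpret L: prob_space L by fact
  interpret DL: pair_prob_space D L ..
  fix f g :: "real ^ 'd \<Rightarrow> real"
  assume f: "mono f" and g: "mono g"
    and [measurable]: "f \<in> borel_measurable borel" "g \<in> borel_measurable borel"
  define f' g' where "f' = (\<lambda>e w. f (e *\<^sub>R 1 + w))" and "g' = (\<lambda>e w. g (e *\<^sub>R 1 + w))"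
  have eq: "(\<lambda>p. f (case p of (e, w) \<Rightarrow> e *\<^sub>R 1 + w)) = (\<lambda>(e, w). f' e w)"
    "(\<lambda>p. g (case p of (e, w) \<Rightarrow> e *\<^sub>R 1 + w)) = (\<lambda>(e, w). g' e w)"
    by (auto simp: f'_def g'_def)
  assume "covariance_exists (D \<Otimes>\<^sub>M L)
      (\<lambda>p. f (case p of (e, w) \<Rightarrow> e *\<^sub>R 1 + w)) (\<lambda>p. g (case p of (e, w) \<Rightarrow> e *\<^sub>R 1 + w))"
  then have ex: "covariance_exists (D \<Otimes>\<^sub>M L) (\<lambda>(e, w). f' e w) (\<lambda>(e, w). g' e w)"
    unfolding eq .
  then have int: "integrable (D \<Otimes>\<^sub>M L) (\<lambda>(e, w). f' e w)"
      "integrable (D \<Otimes>\<^sub>M L) (\<lambda>(e, w). g' e w)"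
      "integrable (D \<Otimes>\<^sub>M L) (\<lambda>(e, w). f' e w * g' e w)"
    by (auto simp: covariance_exists_def case_prod_unfold)
  define P where "P e \<longleftrightarrow> covariance_exists L (f' e) (g' e)" for e
  define F G H where "F e = L.expectation (f' e)" and "G e = L.expectation (g' e)"
    and "H e = L.expectation (\<lambda>w. f' e w * g' e w)" for e
  have good: "AE e in D. P e"
    using DL.AE_integrable_fst[OF int(1)] DL.AE_integrable_fst[OF int(2)]
      DL.AE_integrable_fst[OF int(3)]
    unfolding P_def covariance_exists_def by auto
  have mono_f': "f' e w \<le> f' e' w'" and mono_g': "g' e w \<le> g' e' w'"
    if "e \<le> e'" "w \<le> w'" for e e' w w'
    unfolding f'_def g'_def using that
    by (auto intro!: monoD[OF f] monoD[OF g] add_mono simp: less_eq_vec_def)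
  \<comment> \<open>A divergent Bochner integral is zero by default, so monotonicity can fail off the good set.\<close>
  have comonotone: "0 \<le> (F x - F y) * (G x - G y)" if "P x" "P y" for x y
  proof -
    have "F a \<le> F b \<and> G a \<le> G b" if "P a" "P b" "a \<le> b" for a b
      using that mono_f' mono_g' unfolding F_def G_def P_def covariance_exists_def
      by (auto intro!: integral_mono)
    then show ?thesis
      using that by (cases x y rule: le_cases) (auto intro: mult_nonneg_nonneg mult_nonpos_nonpos)
  qed
  have le: "F e * G e \<le> H e" if "P e" for e
  proof -
    have "mono (f' e)" "mono (g' e)"
      by (auto intro!: monoI mono_f' mono_g')
    moreover have "f' e \<in> borel_measurable borel" "g' e \<in> borel_measurable borel"
      unfolding f'_def g'_def by measurable
    ultimately show ?thesis
      using L.associated_expectation_mult_le[OF assoc] that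
      unfolding F_def G_def H_def P_def by blast
  qed
  have "D.expectation F * D.expectation G \<le> D.expectation H"
    using DL.integrable_fst[OF int(1)] DL.integrable_fst[OF int(2)] DL.integrable_fst[OF int(3)]
      good comonotone le
    unfolding F_def[abs_def] G_def[abs_def] H_def[abs_def]
    by (rule D.chebyshev_expectation_le)
  moreover have "D.expectation F = DL.expectation (\<lambda>(e, w). f' e w)"
      "D.expectation G = DL.expectation (\<lambda>(e, w). g' e w)"
      "D.expectation H = DL.expectation (\<lambda>(e, w). f' e w * g' e w)"
    using DL.integral_fst[OF int(1)] DL.integral_fst[OF int(2)] DL.integral_fst[OF int(3)]
    by (simp_all add: F_def[abs_def] G_def[abs_def] H_def[abs_def])
  ultimately have "0 \<le> covariance (D \<Otimes>\<^sub>M L) (\<lambda>(e, w). f' e w) (\<lambda>(e, w). g' e w)"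
    unfolding DL.covariance_eq[OF ex] by (simp add: case_prod_unfold)
  then show "0 \<le> covariance (D \<Otimes>\<^sub>M L)
      (\<lambda>p. f (case p of (e, w) \<Rightarrow> e *\<^sub>R 1 + w)) (\<lambda>p. g (case p of (e, w) \<Rightarrow> e *\<^sub>R 1 + w))"
    unfolding eq .
qed

theorem theorem5:
  fixes M :: "'a measure" and Y :: "'a \<Rightarrow> real ^ 'd::finite"
    and N :: "'d \<Rightarrow> 'b measure" and W :: "'d \<Rightarrow> 'b \<Rightarrow> real ^ 'd"
  assumes "prob_space M"
    and "multivariate_pareto M Y"
    and "\<And>k. prob_space (N k)"
    and "\<And>k. extremal_function M Y k (N k) (W k)"
    and "\<And>k. associated (N k) (W k)"
  shows "extremal_associated M Y"
  unfolding extremal_associated_def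
proof
  fix k
  let ?D = "density lborel (exponential_density 1)" and ?L = "distr (N k) borel (W k)"
  have [measurable]: "Y \<in> borel_measurable M"
    using assms(2) by (simp add: multivariate_pareto_def)
  then have Y: "Y \<in> borel_measurable (given_exceeds M Y k)"
    by (simp add: given_exceeds_def)
  have W: "W k \<in> borel_measurable (N k)"
    and law: "distr (given_exceeds M Y k) borel Y = distr (?D \<Otimes>\<^sub>M ?L) borel (\<lambda>(e, w). e *\<^sub>R 1 + w)"
    using assms(4)[of k] by (simp_all add: extremal_function_def)
  have "associated (?D \<Otimes>\<^sub>M ?L) (\<lambda>(e, w). e *\<^sub>R 1 + w)"
  proof (rule associated_diagonal_shift)
    show "prob_space ?D"
      by (rule prob_space_exponential_density) simp
    show "prob_space ?L"
      using assms(3) W by (rule prob_space.prob_space_distr)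
    show "associated ?L (\<lambda>w. w)"
      using assms(5) W by (simp add: associated_distr)
  qed simp_all
  then have "associated (distr (given_exceeds M Y k) borel Y) (\<lambda>x. x)"
    unfolding law by (rule associated_distr[THEN iffD2, rotated]) measurable
  then show "associated (given_exceeds M Y k) Y"
    by (rule associated_distr[OF Y, THEN iffD1])
qed

end
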